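(* Let $D$ be a positive integer. If $G$ is a 2-degenerate graph with $\Delta(G)\le D$, then $\omega(G^2)\le \frac52 D+72$. Furthermore, if $D\ge 1729$, then $\omega(G^2)\le \frac52 D+60$.
   Context: A graph is $k$-degenerate if every subgraph has a vertex of degree at most $k$ (equivalently, there is an ordering of its vertices in which each vertex has at most $k$ neighbors later in the order). The square $G^2$ of a graph $G$ is obtained from $G$ by adding an edge between every pair of vertices at distance 2 in $G$. $\omega(\cdot)$ denotes clique number and $\Delta(\cdot)$ maximum degree. *)

theory Defs
  imports Complex_Main
begin

definition simple_graph :: "'a set \<Rightarrow> ('a \<Rightarrow> 'a \<Rightarrow> bool) \<Rightarrow> bool" where
  "simple_graph V E \<longleftrightarrow> finite V \<and> (\<forall>u v. E u v \<longrightarrow> u \<in> V \<and> v \<in> V)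
     \<and> (\<forall>u v. E u v \<longrightarrow> E v u) \<and> (\<forall>v. \<not> E v v)"

definition degree :: "'a set \<Rightarrow> ('a \<Rightarrow> 'a \<Rightarrow> bool) \<Rightarrow> 'a \<Rightarrow> nat" where
  "degree V E v = card {u \<in> V. E v u}"

definition max_degree :: "'a set \<Rightarrow> ('a \<Rightarrow> 'a \<Rightarrow> bool) \<Rightarrow> nat" where
  "max_degree V E = Max (insert 0 (degree V E ` V))"

text \<open>k-degenerate: every (induced) subgraph on a nonempty vertex set S has a
vertex of degree at most k within S.  Degrees in a non-induced subgraph are
bounded by those in the induced one, so this is the same as quantifying over
all subgraphs.\<close>

definition degenerate :: "nat \<Rightarrow> 'a set \<Rightarrow> ('a \<Rightarrow> 'a \<Rightarrow> bool) \<Rightarrow> bool" where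
  "degenerate k V E \<longleftrightarrow>
     (\<forall>S. S \<subseteq> V \<and> S \<noteq> {} \<longrightarrow> (\<exists>v\<in>S. card {u \<in> S. E v u} \<le> k))"

definition graph_square :: "'a set \<Rightarrow> ('a \<Rightarrow> 'a \<Rightarrow> bool) \<Rightarrow> 'a \<Rightarrow> 'a \<Rightarrow> bool" where
  "graph_square V E u v \<longleftrightarrow> u \<noteq> v \<and> (E u v \<or> (\<exists>w\<in>V. E u w \<and> E w v))"

definition is_clique :: "'a set \<Rightarrow> ('a \<Rightarrow> 'a \<Rightarrow> bool) \<Rightarrow> 'a set \<Rightarrow> bool" where
  "is_clique V E K \<longleftrightarrow> K \<subseteq> V \<and> (\<forall>u\<in>K. \<forall>v\<in>K. u \<noteq> v \<longrightarrow> E u v)"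

definition clique_number :: "'a set \<Rightarrow> ('a \<Rightarrow> 'a \<Rightarrow> bool) \<Rightarrow> nat" where
  "clique_number V E = Max {card K | K. is_clique V E K}"

end

theory Submission
  imports Defs "HOL-Analysis.Convex"
begin

text \<open>Order the vertices so that each has at most two later neighbours, and regard every clique vertex
  \<open>x\<close> as an edge of a multigraph, with the later neighbours of \<open>x\<close> as its ends.  Degrees in the multigraph
  are at most \<open>D\<close>, and \<open>x\<close> is nonincident to at most \<open>D + 4\<close> edges, apart from those \<open>y\<close> that reach \<open>x\<close>
  along one or two forward arcs; there are at most six such \<open>x\<close> for each \<open>y\<close>, and they depend only on the
  ends of \<open>y\<close>.  Suppose the clique has more than \<open>5/2 D + 60\<close> vertices.  By the bound on the number of
  reaching pairs each multigraph vertex has degree at most \<open>30\<close> or more than about \<open>D/2\<close>, and at most \<open>30\<close>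
  edges are not spanned by the set \<open>B\<close> of the latter vertices.  Summing the incidence bounds over the
  spanned edges gives \<open>card B \<le> 6\<close>.  Deleting the at most \<open>18\<close> edges in \<open>B\<close> or among the later
  neighbours of \<open>B\<close> then removes all exceptions, and an averaging over the \<open>15\<close> pairs of
  vertices shows that at most \<open>5/2 (D + 4)\<close> edges are left.\<close>

section \<open>Edge counts in a multigraph with end map \<open>P\<close>\<close>

definition deg :: "'e set \<Rightarrow> ('e \<Rightarrow> 'v set) \<Rightarrow> 'v \<Rightarrow> nat" where
  "deg S P v = card {x \<in> S. v \<in> P x}"

definition mult :: "'e set \<Rightarrow> ('e \<Rightarrow> 'v set) \<Rightarrow> 'v set \<Rightarrow> nat" where
  "mult S P Q = card {x \<in> S. P x = Q}"

definition nonincident :: "'e set \<Rightarrow> ('e \<Rightarrow> 'v set) \<Rightarrow> 'e \<Rightarrow> 'e set" where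
  "nonincident S P x = {y \<in> S. P y \<inter> P x = {}}"

text \<open>A union bound that, unlike \<open>card_nonincident\<close>, allows edges with fewer than
  two ends; these arise from vertices with fewer than two later neighbours.\<close>

lemma card_le_nonincident_deg:
  assumes "finite S" "finite (P x)"
  shows "card S \<le> card (nonincident S P x) + (\<Sum>v\<in>P x. deg S P v)"
proof -
  have "S \<subseteq> nonincident S P x \<union> (\<Union>v\<in>P x. {y \<in> S. v \<in> P y})"
    unfolding nonincident_def by auto
  then have "card S \<le> card (nonincident S P x \<union> (\<Union>v\<in>P x. {y \<in> S. v \<in> P y}))"
    using assms by (intro card_mono) (auto simp: nonincident_def)
  also have "\<dots> \<le> card (nonincident S P x) + card (\<Union>v\<in>P x. {y \<in> S. v \<in> P y})"
    by (rule card_Un_le)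
  also have "\<dots> \<le> card (nonincident S P x) + (\<Sum>v\<in>P x. deg S P v)"
    unfolding deg_def using card_UN_le[OF assms(2)] by (intro add_left_mono)
  finally show ?thesis .
qed

text \<open>Inclusion-exclusion over the edges at \<open>u\<close> and those at \<open>v\<close>; an
  edge of both kinds is parallel to \<open>x\<close>.\<close>

lemma card_nonincident:
  assumes fin: "finite S" and two: "\<And>y. y \<in> S \<Longrightarrow> card (P y) = 2"
    and Px: "P x = {u, v}" "u \<noteq> v"
  shows "card (nonincident S P x) + deg S P u + deg S P v = card S + mult S P {u, v}"
proof -
  let ?U = "{y \<in> S. u \<in> P y}" and ?V = "{y \<in> S. v \<in> P y}"
  have "P y = {u, v}" if "y \<in> S" "u \<in> P y" "v \<in> P y" for y
  proof -
    have "finite (P y)" using two[OF that(1)] by (metis card.infinite zero_neq_numeral)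
    then show ?thesis
      using card_subset_eq[of "P y" "{u, v}"] that two[OF that(1)] Px(2) by auto
  qed
  then have "?U \<inter> ?V = {y \<in> S. P y = {u, v}}" by auto
  then have "card ?U + card ?V = card (?U \<union> ?V) + mult S P {u, v}"
    unfolding mult_def using card_Un_Int[of ?U ?V] fin by simp
  moreover have "nonincident S P x = S - (?U \<union> ?V)"
    unfolding nonincident_def Px by auto
  then have "card (nonincident S P x) + card (?U \<union> ?V) = card S"
    using fin by (simp add: card_Diff_subset card_mono)
  ultimately show ?thesis unfolding deg_def by simp
qed

text \<open>Double counting of incidences: \<open>f = 1\<close> gives the handshake identity,
  \<open>f = deg S P\<close> the sum of squared degrees.\<close>

lemma sum_deg:
  fixes f :: "'v \<Rightarrow> real"
  assumes "finite S" "finite B" "\<And>x. x \<in> S \<Longrightarrow> P x \<subseteq> B"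
  shows "(\<Sum>v\<in>B. f v * deg S P v) = (\<Sum>x\<in>S. \<Sum>v\<in>P x. f v)"
proof -
  have "(\<Sum>x\<in>S. \<Sum>v\<in>P x. f v) = (\<Sum>x\<in>S. \<Sum>v | v \<in> B \<and> v \<in> P x. f v)"
    using assms(3) by (intro sum.cong refl) blast+
  also have "\<dots> = (\<Sum>v\<in>B. \<Sum>x | x \<in> S \<and> v \<in> P x. f v)"
    using assms(1,2) by (rule sum.swap_restrict)
  also have "\<dots> = (\<Sum>v\<in>B. f v * deg S P v)"
    by (simp add: deg_def mult.commute)
  finally show ?thesis ..
qed

lemma deg_eq_sum_mult:
  assumes "finite S" "finite B" "\<And>x. x \<in> S \<Longrightarrow> P x \<subseteq> B" "\<And>x. x \<in> S \<Longrightarrow> card (P x) = 2"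
  shows "deg S P v = (\<Sum>u\<in>B - {v}. mult S P {v, u})"
proof -
  have "{x \<in> S. v \<in> P x} = (\<Union>u\<in>B - {v}. {x \<in> S. P x = {v, u}})"
  proof (intro equalityI subsetI)
    fix x assume "x \<in> {x \<in> S. v \<in> P x}"
    then have x: "x \<in> S" "v \<in> P x" by auto
    obtain a b where "P x = {a, b}" "a \<noteq> b"
      using assms(4)[OF x(1)] by (auto simp: card_2_iff)
    then have "\<exists>u. P x = {v, u} \<and> u \<noteq> v" using x(2) by (auto simp: doubleton_eq_iff)
    then obtain u where "P x = {v, u}" "u \<noteq> v" by blast
    then show "x \<in> (\<Union>u\<in>B - {v}. {x \<in> S. P x = {v, u}})"
      using x assms(3)[OF x(1)] by auto
  qed auto
  then have "deg S P v = card (\<Union>u\<in>B - {v}. {x \<in> S. P x = {v, u}})"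
    unfolding deg_def by simp
  also have "\<dots> = (\<Sum>u\<in>B - {v}. mult S P {v, u})"
    unfolding mult_def using assms(1,2)
    by (intro card_UN_disjoint) (auto simp: doubleton_eq_iff)
  finally show ?thesis .
qed

section \<open>Multigraphs with few nonincident pairs of edges\<close>

text \<open>Here \<open>y\<close> and \<open>z\<close> are nonadjacent among six vertices; the other four have degrees \<open>A\<^sub>i\<close> and are joined
  to \<open>y\<close> by \<open>p\<^sub>i\<close> edges.  Of the alternatives for \<open>(y, z)\<close> and for \<open>(z, y)\<close>, only the two first ones are
  compatible, so \<open>dy + dz \<ge> 4 * N - 8 * \<Delta>\<close>: nonadjacent pairs satisfy the bound of adjacent ones.\<close>

lemma nonadjacent_vertex:
  fixes N \<Delta> dy dz A1 A2 A3 A4 p1 p2 p3 p4 :: real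
  assumes N: "2 * N > 5 * \<Delta>"
    and sum: "dy + dz + A1 + A2 + A3 + A4 = 2 * N"
    and p: "p1 + p2 + p3 + p4 = dy" "dy > 0"
    and le: "dy \<le> \<Delta>" "A1 \<le> \<Delta>" "A2 \<le> \<Delta>" "A3 \<le> \<Delta>" "A4 \<le> \<Delta>"
    and gt: "2 * A1 > \<Delta>" "2 * A2 > \<Delta>" "2 * A3 > \<Delta>" "2 * A4 > \<Delta>"
    and adj: "p1 = 0 \<or> dy + A1 - p1 \<ge> N - \<Delta>" "p2 = 0 \<or> dy + A2 - p2 \<ge> N - \<Delta>"
      "p3 = 0 \<or> dy + A3 - p3 \<ge> N - \<Delta>" "p4 = 0 \<or> dy + A4 - p4 \<ge> N - \<Delta>"
  shows "2 * dy \<ge> 2 * N - 4 * \<Delta> + dz \<or> dy > dz"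
proof -
  \<comment> \<open>At least three of the multiplicities are nonzero: two \<open>adj\<close> bounds
    would add up to \<open>2 * N <= dy + A + B + 2 * \<Delta> <= 5 * \<Delta>\<close>, and a single
    one would force a degree above \<open>\<Delta>\<close>.\<close>
  have two: "\<not> (p = 0 \<and> q = 0)"
    if "p + q + r + s = dy" "A \<le> \<Delta>" "B \<le> \<Delta>"
      "r = 0 \<or> dy + A - r \<ge> N - \<Delta>" "s = 0 \<or> dy + B - s \<ge> N - \<Delta>" for p q r s A B
  proof
    assume "p = 0 \<and> q = 0"
    then have "r + s = dy" using that(1) by simp
    then show False using that(2-) N p(2) le(1) by argo
  qed
  \<comment> \<open>Adding the three bounds and eliminating \<open>B + C + F\<close> by the degree
    sum gives \<open>dy - dz >= N - 3 * \<Delta> + A > 0\<close>.\<close>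
  have three: "dy > dz"
    if "q + r + s = dy" "dy + dz + A + B + C + F = 2 * N" "2 * A > \<Delta>"
      "dy + B - q \<ge> N - \<Delta>" "dy + C - r \<ge> N - \<Delta>" "dy + F - s \<ge> N - \<Delta>" for q r s A B C F
    using that N by argo
  show ?thesis
  proof (cases "p1 = 0 \<or> p2 = 0 \<or> p3 = 0 \<or> p4 = 0")
    case False
    then have "4 * dy + (A1 + A2 + A3 + A4) - (p1 + p2 + p3 + p4) \<ge> 4 * (N - \<Delta>)" using adj by argo
    then show ?thesis using p(1) sum by argo
  next
    case True
    then show ?thesis
    proof (elim disjE)
      assume z: "p1 = 0"
      then have "p2 \<noteq> 0" "p3 \<noteq> 0" "p4 \<noteq> 0"
        using two[of p1 p2 p3 p4 A3 A4] two[of p1 p3 p2 p4 A2 A4] two[of p1 p4 p2 p3 A2 A3] p(1) le adj by auto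
      then show ?thesis using three[of p2 p3 p4 A1 A2 A3 A4] z p(1) sum gt adj by auto
    next
      assume z: "p2 = 0"
      then have "p1 \<noteq> 0" "p3 \<noteq> 0" "p4 \<noteq> 0"
        using two[of p2 p1 p3 p4 A3 A4] two[of p2 p3 p1 p4 A1 A4] two[of p2 p4 p1 p3 A1 A3] p(1) le adj by auto
      then show ?thesis using three[of p1 p3 p4 A2 A1 A3 A4] z p(1) sum gt adj by auto
    next
      assume z: "p3 = 0"
      then have "p1 \<noteq> 0" "p2 \<noteq> 0" "p4 \<noteq> 0"
        using two[of p3 p1 p2 p4 A2 A4] two[of p3 p2 p1 p4 A1 A4] two[of p3 p4 p1 p2 A1 A2] p(1) le adj by auto
      then show ?thesis using three[of p1 p2 p4 A3 A1 A2 A4] z p(1) sum gt adj by auto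
    next
      assume z: "p4 = 0"
      then have "p1 \<noteq> 0" "p2 \<noteq> 0" "p3 \<noteq> 0"
        using two[of p4 p1 p2 p3 A2 A3] two[of p4 p2 p1 p3 A1 A3] two[of p4 p3 p1 p2 A1 A2] p(1) le adj by auto
      then show ?thesis using three[of p1 p2 p3 A4 A1 A2 A3] z p(1) sum gt adj by auto
    qed
  qed
qed

text \<open>If all pairs satisfy \<open>d y + d z - m y z >= N - D\<close>, summing over the 30
  ordered pairs of six vertices gives \<open>30 * (N - D) <= 18 * N\<close>, so
  \<open>2 * N <= 5 * D\<close>. For adjacent pairs the bound restates \<open>non\<close>;
  nonadjacent ones need \<open>nonadjacent_vertex\<close>.\<close>

lemma six_vertex_bound:
  fixes \<Delta> :: nat
  assumes fin: "finite S" "finite B" and P: "\<And>x. x \<in> S \<Longrightarrow> P x \<subseteq> B" "\<And>x. x \<in> S \<Longrightarrow> card (P x) = 2"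
    and B: "card B \<le> 6"
    and d: "\<And>v. v \<in> B \<Longrightarrow> deg S P v \<le> \<Delta>"
    and non: "\<And>x. x \<in> S \<Longrightarrow> card (nonincident S P x) \<le> \<Delta>"
  shows "2 * card S \<le> 5 * \<Delta>"
proof (rule ccontr)
  assume contr: "\<not> ?thesis"
  define N where "N = real (card S)"
  define d where "d = (\<lambda>v. real (deg S P v))"
  define m where "m = (\<lambda>u v. real (mult S P {u, v}))"
  define D where "D = real \<Delta>"
  have N: "2 * N > 5 * D" using contr unfolding N_def D_def by linarith
  have D0: "D \<ge> 0" unfolding D_def by simp
  have dD: "d v \<le> D" if "v \<in> B" for v using assms(6)[OF that] unfolding d_def D_def by simp
  have m_nonneg: "m u v \<ge> 0" for u v unfolding m_def by simp
  have m_comm: "m u v = m v u" for u v unfolding m_def by (simp add: insert_commute)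
  have sum_d: "sum d B = 2 * N"
    using sum_deg[where f="\<lambda>_. 1" and P=P, OF fin P(1)] P(2) unfolding d_def N_def by simp
  \<comment> \<open>A missing or isolated vertex would leave a degree sum of at most
    \<open>5 * D\<close>, below \<open>2 * N\<close>.\<close>
  have card6: "card B = 6" and pos: "d v > 0" if "v \<in> B" for v
  proof -
    show "card B = 6"
    proof (rule ccontr)
      assume "card B \<noteq> 6"
      then have "real (card B) * D \<le> 5 * D" using B D0 by (intro mult_right_mono) auto
      moreover have "sum d B \<le> real (card B) * D" using dD by (intro sum_bounded_above) auto
      ultimately show False using N sum_d by linarith
    qed
    show "d v > 0"
    proof (rule ccontr)
      assume "\<not> d v > 0"
      then have "sum d B \<le> sum d (B - {v})" using fin that by (subst sum.remove[of B v]) auto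
      also have "\<dots> \<le> real (card (B - {v})) * D" using dD by (intro sum_bounded_above) auto
      also have "\<dots> \<le> 5 * D" using B D0 that fin by (intro mult_right_mono) (auto simp: card_Diff_singleton)
      finally show False using N sum_d by linarith
    qed
  qed
  have "B \<noteq> {}" using N sum_d D0 by auto
  then have card6: "card B = 6" using card6 by auto
  have d_eq: "d v = (\<Sum>u\<in>B - {v}. m v u)" for v
    using deg_eq_sum_mult[where P=P, OF fin P] unfolding d_def m_def by simp
  have adj: "m u v = 0 \<or> d u + d v - m u v \<ge> N - D" if "u \<noteq> v" for u v
  proof (cases "mult S P {u, v} = 0")
    case False
    then have "{x \<in> S. P x = {u, v}} \<noteq> {}" unfolding mult_def by (metis card.empty)
    then obtain x where x: "x \<in> S" "P x = {u, v}" by blast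
    then show ?thesis using card_nonincident[where P=P, OF fin(1) P(2) x(2) that] non[OF x(1)]
      unfolding d_def m_def N_def D_def by linarith
  qed (simp add: m_def)
  have half: "2 * d v > D" if v: "v \<in> B" for v
  proof -
    have "\<exists>u\<in>B - {v}. m v u \<noteq> 0" using pos[OF v] d_eq[of v] by (metis less_irrefl sum.neutral)
    then obtain u where u: "u \<in> B" "u \<noteq> v" "m v u \<noteq> 0" by blast
    then have "d v + d u - m v u \<ge> N - D" using adj[of v u] by auto
    then show ?thesis using dD[OF u(1)] m_nonneg[of v u] u(3) N by linarith
  qed
  have all: "d y + d z - m y z \<ge> N - D" if yz: "y \<in> B" "z \<in> B" "y \<noteq> z" for y z
  proof (rule ccontr)
    assume H: "\<not> ?thesis"
    then have m0: "m y z = 0" using adj[OF yz(3)] by auto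
    have "card (B - {y, z}) = 4" using yz card6 fin by (simp add: card_Diff_subset)
    then obtain a b c e where abce: "B - {y, z} = {a, b, c, e}" "distinct [a, b, c, e]"
      by (auto simp: card_Suc_eq numeral_eq_Suc) 
    have in_B: "a \<in> B" "b \<in> B" "c \<in> B" "e \<in> B" and
      ne: "y \<noteq> a" "y \<noteq> b" "y \<noteq> c" "y \<noteq> e" "z \<noteq> a" "z \<noteq> b" "z \<noteq> c" "z \<noteq> e"
      using abce(1) by blast+
    have "B - {y} = insert z {a, b, c, e}" "B - {z} = insert y {a, b, c, e}"
      and Beq: "B = insert y (insert z {a, b, c, e})"
      using abce(1) yz by auto
    then have dy: "m y a + m y b + m y c + m y e = d y" and dz: "m z a + m z b + m z c + m z e = d z"
      using d_eq[of y] d_eq[of z] m0 m_comm[of y z] ne abce(2) yz(3) by auto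
    have sum6: "d y + d z + d a + d b + d c + d e = 2 * N"
      using sum_d unfolding Beq using ne abce(2) yz(3) by auto
    note outer = dD[OF in_B(1)] dD[OF in_B(2)] dD[OF in_B(3)] dD[OF in_B(4)]
      half[OF in_B(1)] half[OF in_B(2)] half[OF in_B(3)] half[OF in_B(4)]
    have "2 * d y \<ge> 2 * N - 4 * D + d z \<or> d y > d z"
      by (rule nonadjacent_vertex[OF N sum6 dy pos[OF yz(1)] dD[OF yz(1)] outer
            adj[OF ne(1)] adj[OF ne(2)] adj[OF ne(3)] adj[OF ne(4)]])
    moreover have "d z + d y + d a + d b + d c + d e = 2 * N" using sum6 by simp
    then have "2 * d z \<ge> 2 * N - 4 * D + d y \<or> d z > d y"
      by (rule nonadjacent_vertex[OF N _ dz pos[OF yz(2)] dD[OF yz(2)] outer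
            adj[OF ne(5)] adj[OF ne(6)] adj[OF ne(7)] adj[OF ne(8)]])
    \<comment> \<open>Both first alternatives together give
      \<open>d y + d z >= 4 * N - 8 * D > N - D\<close>; a mixed choice forces a degree above
      \<open>D\<close>.\<close>
    ultimately show False using H m0 N dD[OF yz(1)] dD[OF yz(2)] D0 by linarith
  qed
  have "(\<Sum>y\<in>B. \<Sum>z\<in>B - {y}. N - D) \<le> (\<Sum>y\<in>B. \<Sum>z\<in>B - {y}. d y + d z - m y z)"
    using all by (intro sum_mono) auto
  also have "\<dots> = (\<Sum>y\<in>B. 5 * d y + (2 * N - d y) - d y)"
  proof (intro sum.cong refl)
    fix y assume y: "y \<in> B"
    have "sum d (B - {y}) = 2 * N - d y" using sum_d sum.remove[OF fin(2) y, of d] by simp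
    then show "(\<Sum>z\<in>B - {y}. d y + d z - m y z) = 5 * d y + (2 * N - d y) - d y"
      using y card6 fin by (simp add: sum.distrib sum_subtractf d_eq[symmetric])
  qed
  also have "\<dots> = 18 * N"
    by (simp add: sum.distrib sum_subtractf sum_distrib_left[symmetric] card6 sum_d)
  finally show False using N by (simp add: card6 fin)
qed

text \<open>Summing \<open>card_nonincident\<close> over \<open>S\<close> bounds the sum of squared
  degrees from below. As all degrees lie between \<open>D/2 - 4\<close> and \<open>D\<close>, that
  sum is also at most linear in the degree sum, minus a fixed amount per vertex, which limits the
  number of vertices.\<close>

lemma card_vertices_le_six:
  fixes D :: nat
  assumes fin: "finite S" "finite B" and P: "\<And>x. x \<in> S \<Longrightarrow> P x \<subseteq> B" "\<And>x. x \<in> S \<Longrightarrow> card (P x) = 2"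
    and d: "\<And>v. v \<in> B \<Longrightarrow> deg S P v \<le> D" "\<And>v. v \<in> B \<Longrightarrow> real D / 2 - 4 \<le> deg S P v"
    and D: "D \<ge> 8"
    and non: "(\<Sum>x\<in>S. card (nonincident S P x)) \<le> card S * (D + 10)"
    and S: "real (card S) \<ge> 5/2 * real D + 30"
  shows "card B \<le> 6"
proof (rule ccontr)
  assume "\<not> ?thesis"
  then have n: "card B \<ge> 7" by simp
  define N where "N = real (card S)"
  define d where "d = (\<lambda>v. real (deg S P v))"
  define R where "R = real D"
  \<comment> \<open>Ordered pairs of parallel edges, each edge being parallel to itself.\<close>
  define M where "M = (\<Sum>x\<in>S. real (mult S P (P x)))"
  have N: "N \<ge> 5/2 * R + 30" and R: "R \<ge> 8" using S D unfolding N_def R_def by auto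
  have each: "real (card (nonincident S P x)) = N + mult S P (P x) - (\<Sum>v\<in>P x. d v)" if x: "x \<in> S" for x
  proof -
    obtain u v where uv: "P x = {u, v}" "u \<noteq> v" using P(2)[OF x] by (auto simp: card_2_iff)
    then show ?thesis using card_nonincident[where P=P, OF fin(1) P(2) uv] unfolding d_def N_def by simp
  qed
  have sq: "(\<Sum>x\<in>S. \<Sum>v\<in>P x. d v) = (\<Sum>v\<in>B. d v * d v)"
    using sum_deg[where f=d and P=P, OF fin P(1)] unfolding d_def by simp
  have sum_d: "sum d B = 2 * N"
    using sum_deg[where f="\<lambda>_. 1" and P=P, OF fin P(1)] P(2) unfolding d_def N_def by simp
  have "(\<Sum>x\<in>S. real (card (nonincident S P x))) \<le> N * (R + 10)"
    using of_nat_mono[OF non, where ?'a=real] unfolding N_def R_def by simp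
  moreover have "(\<Sum>x\<in>S. real (card (nonincident S P x))) = N * N + M - (\<Sum>v\<in>B. d v * d v)"
    by (simp add: each sum.distrib sum_subtractf sq M_def N_def)
  ultimately have 1: "N * (N - R - 10) + M \<le> (\<Sum>v\<in>B. d v * d v)" by (simp add: algebra_simps)
  have "(\<Sum>v\<in>B. d v * d v) \<le> (\<Sum>v\<in>B. (3/2 * R - 4) * d v - R * (R/2 - 4))"
  proof (intro sum_mono)
    fix v assume "v \<in> B"
    then have "(R - d v) * (d v - (R/2 - 4)) \<ge> 0"
      using d[of v] unfolding d_def R_def by (intro mult_nonneg_nonneg) auto
    then show "d v * d v \<le> (3/2 * R - 4) * d v - R * (R/2 - 4)" by (simp add: field_simps)
  qed
  also have "\<dots> = (3/2 * R - 4) * (2 * N) - card B * (R * (R/2 - 4))"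
    by (simp add: sum_subtractf sum_distrib_left[symmetric] sum_d)
  finally have 2: "N * (N - 4 * R - 2) + card B * (R * (R/2 - 4)) + M \<le> 0"
    using 1 by (simp add: algebra_simps)
  \<comment> \<open>\<open>N * (N - 4 * R - 2)\<close> is increasing from the lower bound of
    \<open>N\<close> on.\<close>
  have 3: "N * (N - 4 * R - 2) \<ge> (5/2 * R + 30) * ((5/2 * R + 30) - 4 * R - 2)"
  proof -
    have "(N - (5/2 * R + 30)) * (N + (5/2 * R + 30) - 4 * R - 2) \<ge> 0"
      using N R by (intro mult_nonneg_nonneg) auto
    then show ?thesis by (simp add: field_simps)
  qed
  have 4: "R * (R/2 - 4) \<ge> 0" using R by auto
  show False
  proof (cases "card B \<ge> 8")
    case True
    then have "8 * (R * (R/2 - 4)) \<le> card B * (R * (R/2 - 4))" using 4 by (intro mult_right_mono) auto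
    moreover have "M \<ge> 0" unfolding M_def by (simp add: sum_nonneg)
    \<comment> \<open>The left side equals \<open>(R / 2 - 7)^2 + 791\<close>.\<close>
    ultimately have "R * R / 4 - 7 * R + 840 \<le> 0" using 2 3 by (simp add: algebra_simps)
    moreover have "(R / 2 - 7) * (R / 2 - 7) \<ge> 0" by simp
    ultimately show False by (simp add: algebra_simps)
  next
    case False
    then have n7: "card B = 7" using n by simp
    \<comment> \<open>With seven vertices \<open>M\<close> must be kept: facts \<open>2\<close> and
      \<open>3\<close> leave \<open>M <= R^2/4 + 3 * R - 840\<close>, while Cauchy-Schwarz over the
      21 pairs gives \<open>M >= N^2/21\<close>, which exceeds
      \<open>25/84 * R^2 + 7 * R\<close>.\<close>
    define Q where "Q = {A. A \<subseteq> B \<and> card A = 2}"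
    have Q: "finite Q" "card Q = 21"
      using n_subsets[OF fin(2), of 2] fin(2) n7 unfolding Q_def by (auto simp: choose_two)
    have im: "P ` S \<subseteq> Q" using P unfolding Q_def by auto
    have "M = (\<Sum>A\<in>Q. real (mult S P A) ^ 2)"
      using sum_fun_comp[OF fin(1) Q(1) im, of "\<lambda>A. real (mult S P A)"]
      unfolding M_def mult_def by (simp add: power2_eq_square)
    moreover have "N = (\<Sum>A\<in>Q. real (mult S P A))"
      using sum_fun_comp[OF fin(1) Q(1) im, of "\<lambda>A. 1::real"]
      unfolding N_def mult_def by simp
    ultimately have "N ^ 2 \<le> M * 21"
      using sum_squared_le_sum_of_squares[of "\<lambda>A. real (mult S P A)" Q] Q by simp
    moreover have "(5/2 * R + 30) ^ 2 \<le> N ^ 2" using N R by (intro power_mono) auto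
    moreover have "M * 2 + 2 * (N * N) + 7 * (R * R) \<le> 4 * N + 8 * (N * R) + 56 * R"
      using 2 n7 by (simp add: field_simps)
    moreover have "8 * N + 16 * (N * R) + 100 * R + 3360 \<le> 4 * (N * N) + 15 * (R * R)"
      using 3 by (simp add: field_simps)
    moreover have "(5/2 * R + 30) ^ 2 = 25/4 * (R * R) + 150 * R + 900"
      by (simp add: power2_eq_square field_simps)
    moreover have "R * R \<ge> 0" by simp
    ultimately show False using R unfolding power2_eq_square by linarith
  qed
qed

section \<open>Degeneracy orderings\<close>

lemma degeneracy_ranking:
  assumes "finite V" "degenerate k V E"
  shows "\<exists>f :: 'a \<Rightarrow> nat. inj_on f V \<and> (\<forall>v\<in>V. card {u \<in> V. E v u \<and> f v < f u} \<le> k)"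
  using assms
proof (induction "card V" arbitrary: V)
  case 0
  then show ?case by auto
next
  case (Suc n)
  then have "V \<noteq> {}" by auto
  then obtain v where v: "v \<in> V" "card {u \<in> V. E v u} \<le> k"
    using Suc.prems(2) unfolding degenerate_def by blast
  have "degenerate k (V - {v}) E"
    using Suc.prems(2) unfolding degenerate_def by blast
  moreover have n: "n = card (V - {v})" using Suc.hyps(2) Suc.prems(1) v(1) by simp
  ultimately obtain f :: "'a \<Rightarrow> nat" where f: "inj_on f (V - {v})"
    "\<And>w. w \<in> V - {v} \<Longrightarrow> card {u \<in> V - {v}. E w u \<and> f w < f u} \<le> k"
    using Suc.hyps(1)[OF n] Suc.prems(1) by blast
  \<comment> \<open>The vertex of small degree goes first, so all its neighbours are later;
    \<open>Suc\<close> frees rank 0 for it and preserves the order of the rest.\<close>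
  define g where "g = (\<lambda>w. if w = v then 0 else Suc (f w))"
  have "inj_on g V" using f(1) unfolding inj_on_def g_def by auto
  moreover have "card {u \<in> V. E w u \<and> g w < g u} \<le> k" if w: "w \<in> V" for w
  proof (cases "w = v")
    case True
    have "card {u \<in> V. E w u \<and> g w < g u} \<le> card {u \<in> V. E v u}"
      using True Suc.prems(1) by (intro card_mono) auto
    then show ?thesis using v(2) by simp
  next
    case False
    then have "{u \<in> V. E w u \<and> g w < g u} = {u \<in> V - {v}. E w u \<and> f w < f u}"
      unfolding g_def by auto
    then show ?thesis using f(2)[of w] w False by simp
  qed
  ultimately show ?case by blast
qed

section \<open>Forward arcs and cliques in the square\<close>

locale ranked_graph =
  fixes V :: "'a set" and E :: "'a \<Rightarrow> 'a \<Rightarrow> bool" and f :: "'a \<Rightarrow> nat" and D :: nat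
  assumes graph: "simple_graph V E"
    and inj: "inj_on f V"
    and two_later: "v \<in> V \<Longrightarrow> card {u \<in> V. E v u \<and> f v < f u} \<le> 2"
    and degree_le: "v \<in> V \<Longrightarrow> degree V E v \<le> D"
begin

text \<open>Serves as the end map \<open>P\<close> of the multigraph.\<close>

definition later :: "'a \<Rightarrow> 'a set" where
  "later v = {u \<in> V. E v u \<and> f v < f u}"

definition earlier :: "'a \<Rightarrow> 'a set" where
  "earlier v = {u \<in> V. E v u \<and> f u < f v}"

definition reach :: "'a \<Rightarrow> 'a set" where
  "reach v = later v \<union> (\<Union>u\<in>later v. later u)"

lemma fin: "finite V" and sym: "E u v \<Longrightarrow> E v u" and irrefl: "\<not> E v v"
  and in_V: "E u v \<Longrightarrow> u \<in> V" "E u v \<Longrightarrow> v \<in> V"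
  using graph unfolding simple_graph_def by blast+

lemma later_subset: "later v \<subseteq> V"
  unfolding later_def by auto

lemma finite_later [simp]: "finite (later v)"
  using later_subset fin by (rule finite_subset)

lemma finite_earlier [simp]: "finite (earlier v)"
  by (rule finite_subset[OF _ fin]) (auto simp: earlier_def)

lemma finite_reach [simp]: "finite (reach v)"
  unfolding reach_def by simp

lemma card_later: "v \<in> V \<Longrightarrow> card (later v) \<le> 2"
  using two_later unfolding later_def .

lemma adjacent_cases: "E u v \<Longrightarrow> v \<in> later u \<or> v \<in> earlier u"
proof -
  assume e: "E u v"
  then have "f u \<noteq> f v" using inj in_V irrefl unfolding inj_on_def by metis
  then show ?thesis using e in_V unfolding later_def earlier_def by auto
qed

lemma in_earlier_iff: "u \<in> V \<Longrightarrow> v \<in> V \<Longrightarrow> u \<in> earlier v \<longleftrightarrow> v \<in> later u"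
  unfolding later_def earlier_def using sym by blast

lemma card_later_earlier:
  assumes "v \<in> V"
  shows "card (later v) + card (earlier v) \<le> D"
proof -
  have "later v \<inter> earlier v = {}" unfolding later_def earlier_def by auto
  then have "card (later v) + card (earlier v) = card (later v \<union> earlier v)"
    by (simp add: card_Un_disjoint)
  also have "\<dots> \<le> degree V E v"
    unfolding degree_def later_def earlier_def using fin by (intro card_mono) auto
  finally show ?thesis using degree_le[OF assms] by simp
qed

text \<open>The factor \<open>l = card (later v)\<close> is kept because later neighbours also use
  up degree: \<open>3 * l + (D - l) = D + 2 * l\<close>, at most \<open>D + 4\<close>.\<close>

lemma card_reach:
  assumes "v \<in> V"
  shows "card (reach v) \<le> 3 * card (later v)"
proof -
  have "card (\<Union>u\<in>later v. later u) \<le> (\<Sum>u\<in>later v. card (later u))"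
    by (intro card_UN_le) simp
  also have "\<dots> \<le> card (later v) * 2"
    using sum_bounded_above[of "later v" "\<lambda>u. card (later u)" 2] card_later later_subset by auto
  finally show ?thesis unfolding reach_def
    using card_Un_le[of "later v" "\<Union>u\<in>later v. later u"] by linarith
qed

lemma deg_later_le:
  assumes "S \<subseteq> V" "v \<in> V"
  shows "deg S later v \<le> D"
proof -
  have "deg S later v \<le> card (earlier v)"
    unfolding deg_def later_def earlier_def using assms fin by (intro card_mono) (auto intro: sym)
  then show ?thesis using card_later_earlier[OF assms(2)] by simp
qed

text \<open>Kept apart because these pairs are bounded only in total, counting from the side of
  \<open>y\<close>.\<close>

definition reached_from :: "'a set \<Rightarrow> 'a \<Rightarrow> 'a set" where
  "reached_from S x = {y \<in> S. later y \<inter> later x = {} \<and> x \<in> reach y}"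

text \<open>A common neighbour later than both endpoints is excluded by nonincidence, and one earlier
  than both accounts for a single \<open>y\<close>, as it has only two later neighbours.\<close>

lemma card_nonincident_later:
  assumes S: "is_clique V (graph_square V E) S" and x: "x \<in> S"
  shows "card (nonincident S later x) \<le> D + 4 + card (reached_from S x)"
proof -
  have SV: "S \<subseteq> V" and xV: "x \<in> V"
    using S x unfolding is_clique_def by blast+
  have finS: "finite S" using SV fin by (rule finite_subset)
  let ?T = "\<Union>w\<in>earlier x. later w - {x}"
  \<comment> \<open>An empty \<open>later x\<close> is disjoint from itself, so \<open>x\<close>
    then counts as nonincident to itself; this 1 is absorbed since \<open>reach x\<close> is then
    empty.\<close>
  let ?I = "if later x = {} then {x} else {}"
  have "nonincident S later x \<subseteq> ?I \<union> reach x \<union> ?T \<union> reached_from S x"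
  proof
    fix y assume "y \<in> nonincident S later x"
    then have y: "y \<in> S" "later y \<inter> later x = {}" unfolding nonincident_def by auto
    then have yV: "y \<in> V" using SV by blast
    show "y \<in> ?I \<union> reach x \<union> ?T \<union> reached_from S x"
    proof (cases "y = x")
      case True
      then show ?thesis using y(2) by simp
    next
      case False
      have square: "graph_square V E x y"
        using S x y(1) False unfolding is_clique_def by simp
      have "E x y \<or> (\<exists>w\<in>V. E x w \<and> E w y)"
        using square unfolding graph_square_def by simp
      moreover have "y \<in> reach x \<union> ?T \<union> reached_from S x" if e: "E x y"
      proof (cases "y \<in> later x")
        case False
        then have "x \<in> later y" using adjacent_cases[OF e] in_earlier_iff[OF yV xV] by simp
        then show ?thesis using y unfolding reach_def reached_from_def by simp
      qed (simp add: reach_def)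
      moreover have "y \<in> reach x \<union> ?T \<union> reached_from S x"
        if w: "w \<in> V" "E x w" "E w y" for w
      proof -
        have wx: "w \<in> later x \<or> w \<in> earlier x" and "w \<in> later y \<or> w \<in> earlier y"
          using adjacent_cases[OF w(2)] adjacent_cases[OF sym[OF w(3)]] .
        \<comment> \<open>If \<open>w\<close> is later than \<open>y\<close>, it is not later than
          \<open>x\<close>, leaving a forward path \<open>y\<close>, \<open>w\<close>,
          \<open>x\<close>. Otherwise there is a forward path \<open>x\<close>, \<open>w\<close>,
          \<open>y\<close>, or \<open>w\<close> is earlier than both.\<close>
        then consider "w \<in> later y" | "y \<in> later w" using in_earlier_iff[OF w(1) yV] by blast
        then show ?thesis
        proof cases
          case 1
          then have "x \<in> later w" using wx y(2) in_earlier_iff[OF w(1) xV] by blast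
          then have "x \<in> reach y" using 1 unfolding reach_def by blast
          then show ?thesis using y unfolding reached_from_def by simp
        next
          case 2
          then show ?thesis using wx False unfolding reach_def by auto
        qed
      qed
      ultimately show ?thesis by blast
    qed
  qed
  then have "card (nonincident S later x) \<le> card (?I \<union> reach x \<union> ?T \<union> reached_from S x)"
    using finS by (intro card_mono) (auto simp: reached_from_def)
  also have "\<dots> \<le> card ?I + card (reach x) + card ?T + card (reached_from S x)"
    using card_Un_le[of "?I \<union> reach x \<union> ?T" "reached_from S x"]
      card_Un_le[of "?I \<union> reach x" ?T] card_Un_le[of ?I "reach x"] by linarith
  finally have "card (nonincident S later x) \<le> card ?I + card (reach x) + card ?T + card (reached_from S x)" .
  moreover have "card ?T \<le> card (earlier x)"
  proof -
    have "card (later w - {x}) \<le> 1" if "w \<in> earlier x" for w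
    proof -
      have "w \<in> V" using that unfolding earlier_def by simp
      then have "x \<in> later w" "card (later w) \<le> 2" using that xV in_earlier_iff card_later by auto
      then show ?thesis by simp
    qed
    then show ?thesis
      using card_UN_le[of "earlier x" "\<lambda>w. later w - {x}"]
        sum_bounded_above[of "earlier x" "\<lambda>w. card (later w - {x})" 1] by simp
  qed
  moreover have "card ?I + 2 * card (later x) \<le> 4" using card_later[OF xV] by auto
  ultimately show ?thesis
    using card_reach[OF xV] card_later_earlier[OF xV] by linarith
qed

text \<open>Exchange of summation: \<open>reach y\<close> has at most \<open>2 + 4\<close>
  elements.\<close>

lemma sum_card_reached_from:
  assumes "S \<subseteq> V"
  shows "(\<Sum>x\<in>S. card (reached_from S x)) \<le> 6 * card S"
proof -
  have finS: "finite S" using assms fin by (rule finite_subset)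
  have "(\<Sum>x\<in>S. card (reached_from S x)) \<le> (\<Sum>x\<in>S. \<Sum>y | y \<in> S \<and> x \<in> reach y. 1)"
    unfolding reached_from_def using finS by (intro sum_mono) (auto intro!: card_mono)
  also have "\<dots> = (\<Sum>y\<in>S. \<Sum>x | x \<in> S \<and> x \<in> reach y. 1)"
    by (rule sum.swap_restrict[OF finS finS])
  also have "\<dots> \<le> (\<Sum>y\<in>S. 6)"
  proof (intro sum_mono)
    fix y assume "y \<in> S"
    then have "y \<in> V" using assms by auto
    have "card {x \<in> S. x \<in> reach y} \<le> card (reach y)" by (intro card_mono) auto
    then show "(\<Sum>x | x \<in> S \<and> x \<in> reach y. 1) \<le> (6::nat)"
      using card_reach[OF \<open>y \<in> V\<close>] card_later[OF \<open>y \<in> V\<close>] by simp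
  qed
  finally show ?thesis by simp
qed

section \<open>Structure of a large clique\<close>

lemma card_clique_le:
  assumes S: "is_clique V (graph_square V E) S"
  shows "real (card S) \<le> 5/2 * real D + 60"
proof (rule ccontr)
  assume contr: "\<not> ?thesis"
  \<comment> \<open>Chosen so that an edge with an end of degree \<open>d\<close> has at least
    \<open>t - d\<close> exceptions, the other end having degree at most \<open>D\<close>.\<close>
  define t where "t = real (card S) - 2 * real D - 4"
  define c where "c = (\<lambda>x. real (card (reached_from S x)))"
  have t: "t > real D / 2 + 56" using contr unfolding t_def by simp
  have SV: "S \<subseteq> V" using S unfolding is_clique_def by simp
  have finS: "finite S" using SV fin by (rule finite_subset)
  have later_V: "\<And>x v. v \<in> later x \<Longrightarrow> v \<in> V" using later_subset by auto
  have clique_sub: "is_clique V (graph_square V E) T" if "T \<subseteq> S" for T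
    using S that unfolding is_clique_def by blast
  have "(\<Sum>x\<in>S. c x) \<le> 6 * real (card S)"
    using of_nat_mono[OF sum_card_reached_from[OF SV], where ?'a=real] unfolding c_def by simp
  \<comment> \<open>Equivalent to \<open>card S >= 5/2 * D + 42.5\<close>.\<close>
  also have "\<dots> \<le> 30 * (t - 30)" using contr unfolding t_def by simp
  finally have sum_c: "(\<Sum>x\<in>S. c x) \<le> 30 * (t - 30)" .
  have few: "real (card T) * a \<le> 30 * (t - 30)" if "T \<subseteq> S" "\<And>x. x \<in> T \<Longrightarrow> a \<le> c x" for T a
  proof -
    have "real (card T) * a \<le> (\<Sum>x\<in>T. c x)"
      using sum_mono[of T "\<lambda>_. a" c] that(2) by simp
    also have "\<dots> \<le> (\<Sum>x\<in>S. c x)"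
      using that(1) finS by (intro sum_mono2) (auto simp: c_def)
    finally show ?thesis using sum_c by simp
  qed
  have c_ge': "t + 2 * real D - real (\<Sum>u\<in>later x. deg S later u) \<le> c x + real D" if "x \<in> S" for x
    using card_nonincident_later[OF S that] card_le_nonincident_deg[where x=x and P=later, OF finS finite_later]
    unfolding c_def t_def by linarith
  have sum_le: "(\<Sum>u\<in>A. deg S later u) \<le> D" if "A \<subseteq> V" "card A \<le> 1" for A
  proof -
    have "(\<Sum>u\<in>A. deg S later u) \<le> card A * D"
      using sum_bounded_above[of A "deg S later" D] deg_later_le[OF SV] that(1) by auto
    also have "\<dots> \<le> 1 * D" using that(2) by (intro mult_right_mono) auto
    finally show ?thesis by simp
  qed
  have c_ge: "t - real (deg S later v) \<le> c x" if x: "x \<in> S" and v: "v \<in> later x" for x v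
  proof -
    have "card (later x - {v}) \<le> 1" using card_later[of x] x v SV by auto
    then have "(\<Sum>u\<in>later x - {v}. deg S later u) \<le> D"
      using later_subset[of x] by (intro sum_le) auto
    then have "(\<Sum>u\<in>later x. deg S later u) \<le> deg S later v + D"
      using v by (simp add: sum.remove[of "later x" v])
    then show ?thesis using c_ge'[OF x] by linarith
  qed
  define B where "B = {v \<in> V. deg S later v > 30}"
  have finB: "finite B" unfolding B_def using fin by simp
  \<comment> \<open>Each of the \<open>d\<close> edges at \<open>v\<close> has at least
    \<open>t - d\<close> exceptions, so \<open>d * (t - d) <= 30 * (t - 30)\<close>, that is,
    \<open>(d - 30) * (t - 30 - d) <= 0\<close>: no degree lies strictly between 30 and
    \<open>t - 30\<close>.\<close>
  have B_ge: "real (deg S later v) \<ge> t - 30" if "v \<in> B" for v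
  proof (rule ccontr)
    let ?d = "real (deg S later v)"
    assume "\<not> ?d \<ge> t - 30"
    moreover have "?d > 30" using that unfolding B_def by simp
    ultimately have "(?d - 30) * (t - 30 - ?d) > 0" by simp
    moreover have "?d * (t - ?d) \<le> 30 * (t - 30)"
      using few[of "{x \<in> S. v \<in> later x}" "t - ?d"] c_ge[of _ v] unfolding deg_def by simp
    ultimately show False by (simp add: algebra_simps)
  qed
  define G where "G = {x \<in> S. later x \<subseteq> B \<and> card (later x) = 2}"
  have GS: "G \<subseteq> S" and finG: "finite G" unfolding G_def using finS by auto
  have "real (card (S - G)) * (t - 30) \<le> 30 * (t - 30)"
  proof (rule few)
    fix x assume x: "x \<in> S - G"
    then have xS: "x \<in> S" and bad: "\<not> later x \<subseteq> B \<or> card (later x) < 2"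
      using card_later[of x] SV unfolding G_def by auto
    show "t - 30 \<le> c x"
    proof (cases "later x \<subseteq> B")
      case False
      then obtain v where v: "v \<in> later x" "v \<notin> B" by blast
      then have "deg S later v \<le> 30" using later_V unfolding B_def by auto
      then show ?thesis using c_ge[OF xS v(1)] by linarith
    next
      case True
      then have "(\<Sum>u\<in>later x. deg S later u) \<le> D" using bad later_subset by (intro sum_le) auto
      then show ?thesis using c_ge'[OF xS] by linarith
    qed
  qed auto
  moreover have "t - 30 > 0" using t of_nat_0_le_iff[of D, where ?'a=real] by linarith
  ultimately have "real (card (S - G)) \<le> 30" by (rule mult_right_le_imp_le)
  then have "card (S - G) \<le> 30" by simp
  then have G: "card S \<le> card G + 30" using GS finG by (simp add: card_Diff_subset)
  have G_later: "later x \<subseteq> B" "card (later x) = 2" if "x \<in> G" for x using that unfolding G_def by auto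
  have six: "card B \<le> 6"
  proof (cases "B = {}")
    case False
    show ?thesis
    proof (rule card_vertices_le_six[where P=later, OF finG finB G_later])
      obtain v where "v \<in> B" using False by blast
      then show "D \<ge> 8" using B_ge[of v] deg_later_le[OF SV, of v] t unfolding B_def by auto
      show "deg G later v \<le> D" if "v \<in> B" for v
        using that deg_later_le[OF subset_trans[OF GS SV], of v] unfolding B_def by auto
      \<comment> \<open>Passing from \<open>S\<close> to \<open>G\<close> loses at most 30 edges,
        and \<open>t - 30 - 30 > D/2 - 4\<close>.\<close>
      show "real D / 2 - 4 \<le> real (deg G later v)" if "v \<in> B" for v
      proof -
        have "deg S later v \<le> deg G later v + card (S - G)"
        proof -
          have "{x \<in> S. v \<in> later x} \<subseteq> {x \<in> G. v \<in> later x} \<union> (S - G)" by auto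
          then have "deg S later v \<le> card ({x \<in> G. v \<in> later x} \<union> (S - G))"
            unfolding deg_def using finS finG by (intro card_mono) auto
          then show ?thesis unfolding deg_def using card_Un_le le_trans by blast
        qed
        then show ?thesis using B_ge[OF that] t \<open>card (S - G) \<le> 30\<close> by linarith
      qed
      show "(\<Sum>x\<in>G. card (nonincident G later x)) \<le> card G * (D + 10)"
      proof -
        have "(\<Sum>x\<in>G. card (nonincident G later x)) \<le> (\<Sum>x\<in>G. D + 4 + card (reached_from G x))"
          using card_nonincident_later[OF clique_sub[OF GS]] by (intro sum_mono)
        also have "\<dots> \<le> card G * (D + 4) + 6 * card G"
          using sum_card_reached_from[of G] GS SV by (simp add: sum.distrib)
        finally show ?thesis by (simp add: algebra_simps)
      qed
      show "5/2 * real D + 30 \<le> real (card G)" using G contr by linarith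
    qed auto
  qed simp
  define X where "X = B \<union> (\<Union>v\<in>B. later v)"
  have "card X \<le> card B + card B * 2"
  proof -
    have "card (\<Union>v\<in>B. later v) \<le> (\<Sum>v\<in>B. card (later v))"
      using finB by (intro card_UN_le)
    also have "\<dots> \<le> card B * 2"
      using sum_bounded_above[of B "\<lambda>v. card (later v)" 2] card_later by (auto simp: B_def)
    finally show ?thesis unfolding X_def using card_Un_le[of B "\<Union>v\<in>B. later v"] by linarith
  qed
  then have X: "card X \<le> 18" "finite X" using six finB unfolding X_def by auto
  define T where "T = G - X"
  have TS: "T \<subseteq> S" and finT: "finite T" and TG: "\<And>x. x \<in> T \<Longrightarrow> x \<in> G"
    using GS finG unfolding T_def by auto
  have "2 * card T \<le> 5 * (D + 4)"
  \<comment> \<open>One parameter bounds both degrees and nonincident edges, so the degree bound is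
    relaxed to \<open>D + 4\<close> as well.\<close>
  proof (rule six_vertex_bound[where P=later, OF finT finB G_later(1)[OF TG] G_later(2)[OF TG] six])
    show "deg T later v \<le> D + 4" if "v \<in> B" for v
      using that deg_later_le[OF subset_trans[OF TS SV], of v] unfolding B_def by auto
    show "card (nonincident T later x) \<le> D + 4" if x: "x \<in> T" for x
    proof -
      have "reach y \<subseteq> X" if "y \<in> T" for y
        using G_later(1)[OF TG[OF that]] unfolding reach_def X_def by blast
      then have "reached_from T x = {}" using x unfolding reached_from_def T_def by blast
      then show ?thesis
        using card_nonincident_later[OF clique_sub[OF TS] x] by simp
    qed
  qed (use TG in auto)
  moreover have "card G \<le> card T + card X"
    unfolding T_def using X(2) by (metis add.commute card_Diff_subset_Int diff_card_le_card_Diff le_diff_conv)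
  moreover have "2 * card S > 5 * D + 120" using contr by linarith
  \<comment> \<open>At most \<open>5/2 * (D + 4) + 18 + 30 = 5/2 * D + 58\<close> vertices in
    total.\<close>
  ultimately show False using G X(1) by presburger
qed

end

theorem theorem1:
  fixes V :: "'a set" and E :: "'a \<Rightarrow> 'a \<Rightarrow> bool" and D :: nat
  assumes "D \<ge> 1"
    and "simple_graph V E"
    and "degenerate 2 V E"
    and "max_degree V E \<le> D"
  shows "real (clique_number V (graph_square V E)) \<le> 5/2 * real D + 72
         \<and> (D \<ge> 1729 \<longrightarrow> real (clique_number V (graph_square V E)) \<le> 5/2 * real D + 60)"
proof -
  obtain f :: "'a \<Rightarrow> nat" where f: "inj_on f V"
    "\<And>v. v \<in> V \<Longrightarrow> card {u \<in> V. E v u \<and> f v < f u} \<le> 2"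
    using degeneracy_ranking[OF _ assms(3)] assms(2) unfolding simple_graph_def by blast
  have fin: "finite V" using assms(2) unfolding simple_graph_def by blast
  have "degree V E v \<le> D" if "v \<in> V" for v
  proof -
    have "degree V E v \<le> max_degree V E"
      unfolding max_degree_def using fin that by (intro Max_ge) auto
    then show ?thesis using assms(4) by simp
  qed
  then interpret ranked_graph V E f D
    using assms(2) f by unfold_locales
  let ?C = "{card K | K. is_clique V (graph_square V E) K}"
  have "?C \<subseteq> card ` Pow V" unfolding is_clique_def by blast
  then have "finite ?C" using fin by (meson finite_Pow_iff finite_imageI finite_subset)
  moreover have "is_clique V (graph_square V E) {}" unfolding is_clique_def by simp
  then have "?C \<noteq> {}" by blast
  ultimately have "clique_number V (graph_square V E) \<in> ?C"
    unfolding clique_number_def by (rule Max_in)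
  then obtain K where "is_clique V (graph_square V E) K" "clique_number V (graph_square V E) = card K"
    by blast
  then show ?thesis using card_clique_le[of K] by simp
qed

end
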